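(* For any finite field $F$ of odd characteristic and any $n\ge 4$, the monoid $U^{\pm}_{11}T_n(F)$ is inherently nonfinitely based.
   Context: An $n\times n$ matrix $(\alpha_{ij})$ is triangular if $\alpha_{ij}=0$ whenever $j<i$. For a field $F$ of odd characteristic, $U^{\pm}_{11}T_n(F)$ is the monoid, under matrix multiplication, of all triangular $n\times n$ matrices $(\alpha_{ij})$ over $F$ with $\alpha_{11}\in\{1,-1\}$ and $\alpha_{22},\dots,\alpha_{nn}\in\{0,1\}$. Monoids are considered as semigroups, i.e., in the signature with only the binary multiplication. Let $\mathcal{X}^+$ be the free semigroup on a countably infinite set $\mathcal{X}$ of variables. A semigroup identity is a pair $\mathbf{u}\approx\mathbf{v}$ of words in $\mathcal{X}^+$; it holds in a semigroup $S$ if $\varphi(\mathbf{u})=\varphi(\mathbf{v})$ for every morphism $\varphi:\mathcal{X}^+\to S$. A variety is the class of all semigroups satisfying a given set of identities; it is finitely based if it can be defined by a finite set of identities. The variety $\mathsf{var}\,S$ generated by $S$ is the class of all semigroups satisfying all identities of $S$. A variety is locally finite if all its finitely generated members are finite. A locally finite variety is inherently nonfinitely based if it is not contained in any finitely based, locally finite variety; a semigroup $S$ is inherently nonfinitely based if $\mathsf{var}\,S$ is. *)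

theory Defs
  imports "Jordan_Normal_Form.Matrix" "HOL-Algebra.Group"
begin

section \<open>Semigroups with an explicit carrier\<close>

record 'a sgrp = "'a partial_object" +
  sprod :: "'a \<Rightarrow> 'a \<Rightarrow> 'a"

definition is_semigroup :: "'a sgrp \<Rightarrow> bool" where
  "is_semigroup S \<longleftrightarrow>
     carrier S \<noteq> {} \<and>
     (\<forall>x\<in>carrier S. \<forall>y\<in>carrier S. sprod S x y \<in> carrier S) \<and>
     (\<forall>x\<in>carrier S. \<forall>y\<in>carrier S. \<forall>z\<in>carrier S.
        sprod S (sprod S x y) z = sprod S x (sprod S y z))"

definition sgrp_morphisms :: "'a sgrp \<Rightarrow> 'b sgrp \<Rightarrow> ('a \<Rightarrow> 'b) set" where
  "sgrp_morphisms S T =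
     {\<phi> \<in> carrier S \<rightarrow> carrier T.
        \<forall>x\<in>carrier S. \<forall>y\<in>carrier S. \<phi> (sprod S x y) = sprod T (\<phi> x) (\<phi> y)}"

definition semigroup_reduct :: "'a monoid \<Rightarrow> 'a sgrp" where
  "semigroup_reduct M = \<lparr>carrier = carrier M, sprod = mult M\<rparr>"

inductive_set sgrp_generated :: "'a sgrp \<Rightarrow> 'a set \<Rightarrow> 'a set" for S X where
  incl: "x \<in> X \<Longrightarrow> x \<in> sgrp_generated S X"
| prod: "x \<in> sgrp_generated S X \<Longrightarrow> y \<in> sgrp_generated S X \<Longrightarrow>
           sprod S x y \<in> sgrp_generated S X"

definition finitely_generated :: "'a sgrp \<Rightarrow> bool" where
  "finitely_generated S \<longleftrightarrow>
     (\<exists>X. finite X \<and> X \<subseteq> carrier S \<and> sgrp_generated S X = carrier S)"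

section \<open>Identities\<close>

text \<open>The countably infinite set of variables is \<^typ>\<open>nat\<close>; the elements of the free semigroup
  on it are the nonempty words.\<close>

definition free_sgrp :: "nat list sgrp" where
  "free_sgrp = \<lparr>carrier = {w. w \<noteq> []}, sprod = (@)\<rparr>"

type_synonym identity = "nat list \<times> nat list"

definition identities :: "identity set" where
  "identities = carrier free_sgrp \<times> carrier free_sgrp"

definition holds_in :: "identity \<Rightarrow> 'a sgrp \<Rightarrow> bool" where
  "holds_in e S \<longleftrightarrow> (\<forall>\<phi> \<in> sgrp_morphisms free_sgrp S. \<phi> (fst e) = \<phi> (snd e))"

section \<open>Varieties\<close>

text \<open>A class of semigroups is rendered as a set of semigroups whose carriers are subsets of a
  universe type \<open>'u\<close>. When \<open>'u\<close> is infinite, every countable semigroup has an isomorphic copy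
  over \<open>'u\<close>; since finitely generated semigroups and the free objects of countable rank are
  countable, local finiteness of varieties and inclusion between varieties then do not depend on
  the choice of \<open>'u\<close>.\<close>

definition models :: "identity set \<Rightarrow> 'u sgrp set" where
  "models \<Sigma> = {S. is_semigroup S \<and> (\<forall>e\<in>\<Sigma>. holds_in e S)}"

definition is_variety :: "'u sgrp set \<Rightarrow> bool" where
  "is_variety V \<longleftrightarrow> (\<exists>\<Sigma>. \<Sigma> \<subseteq> identities \<and> V = models \<Sigma>)"

definition finitely_based :: "'u sgrp set \<Rightarrow> bool" where
  "finitely_based V \<longleftrightarrow> (\<exists>\<Sigma>. \<Sigma> \<subseteq> identities \<and> finite \<Sigma> \<and> V = models \<Sigma>)"

text \<open>The generating semigroup need not live over the universe type \<open>'u\<close>.\<close>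

definition var_generated :: "'a sgrp \<Rightarrow> 'u sgrp set" where
  "var_generated S = models {e \<in> identities. holds_in e S}"

definition locally_finite :: "'u sgrp set \<Rightarrow> bool" where
  "locally_finite V \<longleftrightarrow> (\<forall>S\<in>V. finitely_generated S \<longrightarrow> finite (carrier S))"

definition inherently_nfb_variety :: "'u sgrp set \<Rightarrow> bool" where
  "inherently_nfb_variety V \<longleftrightarrow>
     is_variety V \<and> locally_finite V \<and>
     \<not> (\<exists>W. is_variety W \<and> finitely_based W \<and> locally_finite W \<and> V \<subseteq> W)"

definition inherently_nfb :: "'u itself \<Rightarrow> 'a sgrp \<Rightarrow> bool" where
  "inherently_nfb U S \<longleftrightarrow> inherently_nfb_variety (var_generated S :: 'u sgrp set)"

section \<open>The monoid of triangular matrices\<close>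

text \<open>Matrix indices start at 0, so the entry in position (1,1) is \<open>A $$ (0,0)\<close>.\<close>

definition Upm11T :: "nat \<Rightarrow> 'a::field mat monoid" where
  "Upm11T n =
     \<lparr>carrier = {A \<in> carrier_mat n n. upper_triangular A \<and> A $$ (0,0) \<in> {1, -1} \<and>
                   (\<forall>i. 1 \<le> i \<and> i < n \<longrightarrow> A $$ (i,i) \<in> {0, 1})},
      mult = (*), one = 1\<^sub>m n\<rparr>"

lemma upper_triangular_times:
  fixes A B :: "'a::field mat"
  assumes A: "A \<in> carrier_mat n n" "upper_triangular A"
    and B: "B \<in> carrier_mat n n" "upper_triangular B"
  shows "upper_triangular (A * B)"
    and "i < n \<Longrightarrow> (A * B) $$ (i,i) = A $$ (i,i) * B $$ (i,i)"
proof -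
  have e: "(A * B) $$ (i,j) = (\<Sum>k<n. A $$ (i,k) * B $$ (k,j))" if "i < n" "j < n" for i j
    using that A B by (auto simp: scalar_prod_def atLeast0LessThan intro!: sum.cong)
  have z: "A $$ (i,k) * B $$ (k,j) = 0" if "i < n" "k < n" "k < i \<or> j < k" for i j k
    using that A B by (auto simp: upper_triangular_def)
  show "upper_triangular (A * B)"
  proof (rule upper_triangularI)
    fix i j assume "j < i" "i < dim_row (A * B)"
    then have "i < n" "j < n" using A by auto
    then show "(A * B) $$ (i,j) = 0"
      using \<open>j < i\<close> by (subst e) (auto intro!: sum.neutral z)
  qed
  assume i: "i < n"
  have "(A * B) $$ (i,i) = (\<Sum>k<n. if k = i then A $$ (i,i) * B $$ (i,i) else 0)"
    unfolding e[OF i i] using i z by (intro sum.cong) (auto simp: linorder_neq_iff)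
  then show "(A * B) $$ (i,i) = A $$ (i,i) * B $$ (i,i)" using i by simp
qed

lemma monoid_Upm11T:
  assumes "n \<ge> 1"
  shows "monoid (Upm11T n :: 'a::field mat monoid)"
proof (rule monoidI)
  let ?M = "Upm11T n :: 'a mat monoid"
  fix A B assume AB: "A \<in> carrier ?M" "B \<in> carrier ?M"
  then have "A \<in> carrier_mat n n" "upper_triangular A" "B \<in> carrier_mat n n" "upper_triangular B"
    by (auto simp: Upm11T_def)
  note t = upper_triangular_times[OF this]
  have "(A * B) $$ (i,i) \<in> {0, 1}" if "1 \<le> i" "i < n" for i
  proof -
    have "A $$ (i,i) \<in> {0, 1}" "B $$ (i,i) \<in> {0, 1}" using AB that by (auto simp: Upm11T_def)
    then show ?thesis unfolding t(2)[OF that(2)] by auto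
  qed
  moreover have "(A * B) $$ (0,0) \<in> {1, -1}"
  proof -
    have "A $$ (0,0) \<in> {1, -1}" "B $$ (0,0) \<in> {1, -1}" using AB by (auto simp: Upm11T_def)
    moreover have "0 < n" using assms by simp
    ultimately show ?thesis unfolding t(2)[OF \<open>0 < n\<close>] by auto
  qed
  ultimately show "A \<otimes>\<^bsub>?M\<^esub> B \<in> carrier ?M"
    using AB t(1) by (auto simp: Upm11T_def simp del: index_mult_mat(1) intro!: mult_carrier_mat)
qed (use assms in \<open>auto simp: Upm11T_def upper_triangular_def\<close>)

lemma is_semigroup_Upm11T:
  assumes "n \<ge> 1"
  shows "is_semigroup (semigroup_reduct (Upm11T n :: 'a::field mat monoid))"
proof -
  interpret monoid "Upm11T n :: 'a mat monoid" by (rule monoid_Upm11T[OF assms])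
  show ?thesis using one_closed m_assoc by (auto simp: is_semigroup_def semigroup_reduct_def)
qed

end

theory Submission
  imports Defs "HOL-Library.Sublist" "HOL-Library.Countable_Set"
begin

text \<open>Call a word reducible if it can be emptied by deleting letters one after another, where a
  letter \<open>x\<close> may be deleted only if \<open>xx\<close> is not a factor. Every nonempty factor of a reducible
  word contains a letter an odd number of times, so distinct prefixes have distinct parity vectors.
  The signs in position (1,1) then single out each gap of the shortened word (this needs
  \<open>2 \<noteq> 0\<close>), and the lower right 3-by-3 block tells whether \<open>x\<close> occurs there not at all, once,
  or more often. By induction, a reducible word is an isoterm for the matrix monoid.

  On the other hand, iterating a substitution on \<open>r\<^sup>2\<close> letters yields long words such that every word
  in at most \<open>r - 2\<close> variables with a substitution instance among their factors is reducible. The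
  factors of these words together with a zero form an infinite, finitely generated semigroup
  satisfying all identities of the matrix monoid in at most \<open>r - 2\<close> variables, so no finitely based
  variety containing the monoid is locally finite.\<close>

section \<open>Reducible words\<close>

inductive reducible :: "'a list \<Rightarrow> bool" where
  Nil: "reducible []"
| delete: "reducible (filter (\<lambda>y. y \<noteq> x) u) \<Longrightarrow> \<not> sublist [x, x] u \<Longrightarrow> reducible u"

lemma count_list_filter_neq:
  "z \<noteq> x \<Longrightarrow> count_list (filter (\<lambda>y. y \<noteq> x) w) z = count_list w z"
  by (induction w) auto

lemma filter_empty_replicate: "filter (\<lambda>y. y \<noteq> x) w = [] \<Longrightarrow> w = replicate (length w) x"
  by (induction w) (auto split: if_splits)

lemma sublist_filter: "sublist f u \<Longrightarrow> sublist (filter P f) (filter P u)"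
  by (auto simp: sublist_def[of f u] sublist_appendI)

text \<open>Induction on the deletions. If deleting \<open>x\<close> leaves part of
  \<open>f\<close>, a letter of odd count in the remainder has the same count in \<open>f\<close>;
  otherwise \<open>f\<close> is a power of \<open>x\<close>, and since \<open>xx\<close> is not a
  factor, \<open>f\<close> is the single letter \<open>x\<close>.\<close>

lemma reducible_odd_letter:
  assumes "reducible u" "sublist f u" "f \<noteq> []"
  shows "\<exists>z. odd (count_list f z)"
  using assms
proof (induction arbitrary: f rule: reducible.induct)
  case (delete x u)
  show ?case
  proof (cases "filter (\<lambda>y. y \<noteq> x) f = []")
    case True
    obtain n where f: "f = replicate n x" by (rule that[OF filter_empty_replicate[OF True]])
    have "n = 1"
    proof (rule ccontr)
      assume "n \<noteq> 1"
      moreover have "n \<noteq> 0" using f delete.prems(2) by auto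
      ultimately have "2 \<le> n" by linarith
      then obtain k where "n = 2 + k" using le_Suc_ex by blast
      then have "prefix [x, x] f" using f by simp
      then have "sublist [x, x] u"
        using delete.prems(1) sublist_order.order_trans[OF prefix_imp_sublist] by blast
      then show False using delete.hyps(2) by blast
    qed
    then have "odd (count_list f x)" using f by simp
    then show ?thesis ..
  next
    case False
    then obtain z where z: "odd (count_list (filter (\<lambda>y. y \<noteq> x) f) z)"
      using delete.IH delete.prems(1) sublist_filter by blast
    have "z \<noteq> x"
    proof
      assume "z = x"
      then have "count_list (filter (\<lambda>y. y \<noteq> x) f) z = 0" by (simp add: count_list_0_iff)
      then show False using z by simp
    qed
    then show ?thesis using z count_list_filter_neq[of z x f] by auto
  qed
qed (auto simp: sublist_def)

lemma filter_eq_adjacent: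
  assumes "filter P u = p @ x # x # s"
  shows "\<exists>mid. sublist (x # mid @ [x]) u \<and> (\<forall>y\<in>set mid. \<not> P y)"
  using assms
proof (induction p arbitrary: u)
  case Nil
  then obtain m1 u3 where u3: "u = m1 @ x # u3" "filter P u3 = x # s"
    using filter_eq_ConsD[of P u x "x # s"] by auto
  obtain mid u4 where u4: "u3 = mid @ x # u4" "\<forall>y\<in>set mid. \<not> P y"
    using u3(2) by (auto simp: filter_eq_Cons_iff)
  have "u = m1 @ (x # mid @ [x]) @ u4" using u3 u4 by simp
  then show ?case using u4(2) by (metis sublist_appendI)
next
  case (Cons a p)
  then obtain m u' where u': "u = m @ a # u'" "filter P u' = p @ x # x # s"
    by (auto simp: filter_eq_Cons_iff)
  then have "sublist u' u" by (auto intro!: suffix_imp_sublist simp: suffix_def)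
  then show ?case using Cons.IH[OF u'(2)] sublist_order.order_trans by blast
qed

text \<open>The letters of \<open>A\<close> can be deleted one at a time in any order: a factor
  \<open>bb\<close> appearing after some deletions would come from two occurrences of
  \<open>b\<close> in \<open>u\<close> with only letters of \<open>A\<close> between them.\<close>

lemma reducible_extend:
  assumes "finite A" "reducible (filter (\<lambda>y. y \<notin> A) u)"
    and sep: "\<And>x mid. x \<in> A \<Longrightarrow> sublist (x # mid @ [x]) u \<Longrightarrow> \<not> set mid \<subseteq> A"
  shows "reducible u"
proof -
  have "reducible (filter (\<lambda>y. y \<notin> A - B) u)" if "finite B" "B \<subseteq> A" for B
    using that
  proof (induction B rule: finite_induct)
    case (insert b B)
    let ?w = "filter (\<lambda>y. y \<notin> A - insert b B) u"
    have "filter (\<lambda>y. y \<noteq> b) ?w = filter (\<lambda>y. y \<notin> A - B) u"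
      using insert by (auto simp: filter_filter intro!: filter_cong)
    moreover have "\<not> sublist [b, b] ?w"
    proof
      assume "sublist [b, b] ?w"
      then obtain p s where "?w = p @ b # b # s" by (auto simp: sublist_def)
      from filter_eq_adjacent[OF this] show False using sep insert.prems by blast
    qed
    ultimately show ?case using insert.IH insert.prems by (intro reducible.delete[of b ?w, rotated]) simp_all
  qed (use assms(2) in auto)
  from this[OF assms(1)] show ?thesis by simp
qed

section \<open>Iterating the substitution\<close>

text \<open>The second component marks the position modulo \<open>r\<close> in the image words. Both
  coordinates of \<open>a\<close> recur along the whole block, so that each of its
  \<open>r - 1\<close> pairs of neighbouring columns determines \<open>a\<close>; decoding may then
  use a pair that no cut separates.\<close>

definition block :: "nat \<Rightarrow> nat \<times> nat \<Rightarrow> (nat \<times> nat) list" where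
  "block r a = map (\<lambda>c. (if even c then fst a else snd a, c)) [0..<r]"

definition block_word :: "nat \<Rightarrow> (nat \<times> nat) list \<Rightarrow> (nat \<times> nat) list" where
  "block_word r w = concat (map (block r) w)"

definition iterated_block :: "nat \<Rightarrow> nat \<Rightarrow> (nat \<times> nat) list" where
  "iterated_block r m = (block_word r ^^ m) [(0, 0)]"

text \<open>Only the first component of the letter in column \<open>c\<close> of \<open>block r a\<close> depends on \<open>a\<close>, but
  two adjacent letters reveal both components of \<open>a\<close>. The function \<open>decode c\<close> reads off the
  original letter wherever columns \<open>c\<close> and \<open>c + 1\<close> are adjacent.\<close>

fun decode :: "nat \<Rightarrow> (nat \<times> nat) list \<Rightarrow> (nat \<times> nat) list" where
  "decode c (a # b # w) =
     (if snd a = c \<and> snd b = Suc c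
      then [if even c then (fst a, fst b) else (fst b, fst a)] else []) @ decode c (b # w)"
| "decode c [a] = []"
| "decode c [] = []"

text \<open>Only a pair of columns \<open>c\<close>, \<open>c + 1\<close> straddling the cut could
  get lost, and the hypothesis on the head of \<open>w2\<close> excludes such a pair.\<close>

lemma decode_append:
  "w2 = [] \<or> snd (hd w2) \<noteq> Suc c \<Longrightarrow> decode c (w1 @ w2) = decode c w1 @ decode c w2"
proof (induction c w1 rule: decode.induct)
  case (2 c a)
  then show ?case by (cases w2) auto
qed auto

lemma decode_Cons_suffix: "\<exists>e. decode c (a # w) = e @ decode c w"
  by (cases w) auto

lemma decode_append_suffix: "\<exists>e. decode c (p @ w) = e @ decode c w"
proof (induction p)
  case (Cons a p)
  then show ?case using decode_Cons_suffix[of c a "p @ w"] by (metis append_Cons append_assoc)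
qed auto

lemma decode_append_prefix: "\<exists>e. decode c (w @ s) = decode c w @ e"
  by (induction c w rule: decode.induct) auto

lemma sublist_decode: "sublist f g \<Longrightarrow> sublist (decode c f) (decode c g)"
  unfolding sublist_def by (metis decode_append_prefix decode_append_suffix)

lemma decode_columns:
  assumes "\<And>i. snd (g i) = i"
  shows "decode c (map g [m..<n]) =
    (if m \<le> c \<and> Suc c < n
     then [if even c then (fst (g c), fst (g (Suc c))) else (fst (g (Suc c)), fst (g c))] else [])"
proof (induction "n - m" arbitrary: m)
  case (Suc k)
  show ?case
  proof (cases "Suc m < n")
    case True
    then have e: "[m..<n] = m # Suc m # [Suc (Suc m)..<n]" "[Suc m..<n] = Suc m # [Suc (Suc m)..<n]"
      by (simp_all add: upt_conv_Cons)
    have "decode c (map g [Suc m..<n]) =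
      (if Suc m \<le> c \<and> Suc c < n
       then [if even c then (fst (g c), fst (g (Suc c))) else (fst (g (Suc c)), fst (g c))] else [])"
      using Suc by auto
    then show ?thesis using True unfolding e by (auto simp: assms)
  next
    case False
    then have "[m..<n] = [m]" using Suc by (simp add: upt_conv_Cons)
    then show ?thesis using False by auto
  qed
qed auto

lemma decode_block: "Suc c < r \<Longrightarrow> decode c (block r a) = [a]"
  unfolding block_def by (subst decode_columns) auto

text \<open>Every block starts in column 0, so no pair of columns \<open>c\<close>,
  \<open>c + 1\<close> straddles two blocks, and each block contributes its own letter.\<close>

lemma decode_block_word:
  assumes "Suc c < r"
  shows "decode c (block_word r w) = w"
proof (induction w)
  case (Cons a w)
  have "block_word r w = [] \<or> snd (hd (block_word r w)) \<noteq> Suc c"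
    using assms by (cases w) (auto simp: block_word_def block_def upt_conv_Cons)
  then have "decode c (block r a @ block_word r w) = decode c (block r a) @ decode c (block_word r w)"
    by (rule decode_append)
  then show ?case using Cons assms by (simp add: block_word_def decode_block)
qed (simp add: block_word_def)

lemma length_block_word: "length (block_word r w) = r * length w"
  by (induction w) (auto simp: block_word_def block_def)

lemma column_block_word:
  "i < length (block_word r w) \<Longrightarrow> snd (block_word r w ! i) = i mod r"
proof (induction w arbitrary: i)
  case (Cons a w)
  have l: "length (block r a) = r" by (simp add: block_def)
  have e: "block_word r (a # w) = block r a @ block_word r w" by (simp add: block_word_def)
  show ?case
  proof (cases "i < r")
    case True
    then show ?thesis using l unfolding e by (simp add: nth_append) (simp add: block_def)
  next
    case False
    then have "snd (block_word r w ! (i - r)) = (i - r) mod r"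
      using Cons l unfolding e by (intro Cons.IH) auto
    then show ?thesis using False l unfolding e by (simp add: nth_append le_mod_geq)
  qed
qed (simp add: block_word_def)

lemma decode_nonempty:
  "Suc i < length g \<Longrightarrow> snd (g ! i) = c \<Longrightarrow> snd (g ! Suc i) = Suc c \<Longrightarrow> decode c g \<noteq> []"
proof (induction g arbitrary: i)
  case (Cons a g)
  then show ?case
  proof (cases i)
    case 0
    then show ?thesis using Cons by (cases g) auto
  next
    case (Suc j)
    then have "decode c g \<noteq> []" using Cons by auto
    then show ?thesis using decode_Cons_suffix[of c a g] by auto
  qed
qed auto

text \<open>Columns are positions modulo \<open>r\<close>, so two letters in the same column are a
  positive multiple of \<open>r\<close> apart. The factor they bound runs through a full period and
  contains column \<open>c\<close> followed by column \<open>c + 1\<close>.\<close>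

lemma decode_repeated_column:
  assumes "sublist (a # w @ [b]) (block_word r v)" "snd a = snd b" "Suc c < r"
  shows "decode c (a # w @ [b]) \<noteq> []"
proof -
  let ?g = "a # w @ [b]"
  obtain p s where e: "block_word r v = p @ ?g @ s" using assms(1) by (auto simp: sublist_def)
  define d where "d = Suc (length w)"
  have col: "snd (?g ! i) = (length p + i) mod r" if "i \<le> d" for i
  proof -
    have "?g ! i = block_word r v ! (length p + i)" using that unfolding e d_def
      by (auto simp: nth_append nth_Cons split: nat.split)
    moreover have "length p + i < length (block_word r v)" using that unfolding e d_def by simp
    ultimately show ?thesis using column_block_word by metis
  qed
  have "?g ! d = b" by (simp add: d_def)
  then have "(length p + 0) mod r = (length p + d) mod r"
    using col[of 0] col[of d] assms(2) by simp
  then have "r dvd d" by (metis add.right_neutral add_diff_cancel_left' le_add1 mod_eq_dvd_iff_nat)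
  then have "r \<le> d" by (simp add: d_def dvd_imp_le)
  \<comment> \<open>The offset of the first letter of the factor in column \<open>c\<close>, namely
    \<open>c - length p\<close> modulo \<open>r\<close>, written so that natural subtraction does
    not truncate.\<close>
  define i where "i = (c + (r - length p mod r)) mod r"
  have "i < r" using assms(3) by (simp add: i_def)
  have "(length p + i) mod r = (length p mod r + (c + (r - length p mod r))) mod r"
    unfolding i_def by (simp add: mod_simps)
  also have "length p mod r + (c + (r - length p mod r)) = c + r"
    using mod_less_divisor[of r "length p"] assms(3) by linarith
  finally have i: "(length p + i) mod r = c" using assms(3) by simp
  then have "(length p + Suc i) mod r = Suc c" using assms(3) by (simp add: mod_Suc)
  then show ?thesis using col[of i] col[of "Suc i"] i \<open>i < r\<close> \<open>r \<le> d\<close>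
    by (intro decode_nonempty[of i]) (auto simp: d_def)
qed

lemma decode_concat:
  assumes "\<And>x. x \<in> set u \<Longrightarrow> \<theta> x \<noteq> [] \<and> snd (hd (\<theta> x)) \<noteq> Suc c"
  shows "decode c (concat (map \<theta> u)) = concat (map (\<lambda>x. decode c (\<theta> x)) u)"
  using assms
proof (induction u)
  case (Cons x u)
  have "concat (map \<theta> u) = [] \<or> snd (hd (concat (map \<theta> u))) \<noteq> Suc c"
    using Cons.prems by (cases u) auto
  then show ?case using Cons by (simp add: decode_append)
qed auto

lemma concat_map_filter_empty:
  "concat (map f (filter (\<lambda>x. f x \<noteq> []) u)) = concat (map f u)"
  by (induction u) auto

lemma sublist_concat_map: "sublist f u \<Longrightarrow> sublist (concat (map \<theta> f)) (concat (map \<theta> u))"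
  by (auto simp: sublist_def[of f u] sublist_appendI)

text \<open>Some column \<open>c + 1\<close> is not the starting column of any \<open>\<theta> x\<close>, so no cut between variables
  separates columns \<open>c\<close> and \<open>c + 1\<close>, and decoding the images of the variables undoes one
  substitution. Variables with empty decoded image occur at most once between two others, as the
  gap is shorter than a period of the columns; hence they can be deleted one at a time.\<close>

lemma encountered_reducible:
  assumes "\<And>x. x \<in> set u \<Longrightarrow> \<theta> x \<noteq> []"
    and "sublist (concat (map \<theta> u)) (iterated_block r m)"
    and "card (set u) + 2 \<le> r"
  shows "reducible u"
  using assms
proof (induction m arbitrary: u \<theta>)
  case 0
  have "length u \<le> length (concat (map \<theta> u))"
    using 0(1)
  proof (induction u)
    case (Cons x u)
    then have "1 \<le> length (\<theta> x)" "length u \<le> length (concat (map \<theta> u))" by (auto simp: Suc_le_eq)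
    then show ?case by simp
  qed auto
  also have "\<dots> \<le> 1" using sublist_length_le[OF 0(2)] by (simp add: iterated_block_def)
  finally have "u = [] \<or> (\<exists>x. u = [x])" by (cases u) auto
  then show ?case
  proof
    assume "\<exists>x. u = [x]"
    then obtain x where "u = [x]" by auto
    then show ?thesis
      by (auto intro!: reducible.delete[where x = x and u = "[x]"] reducible.Nil dest: sublist_length_le)
  qed (auto intro: reducible.Nil)
next
  case (Suc m)
  \<comment> \<open>Pigeonhole: at most \<open>r - 2\<close> starting columns occur, and
    \<open>r - 1\<close> candidates are available. Column 0 is no candidate because the free column
    must have the form \<open>c + 1\<close>.\<close>
  have "card ((\<lambda>x. snd (hd (\<theta> x))) ` set u) \<le> card (set u)" by (rule card_image_le) simp
  also have "\<dots> < card {1..<r}" using Suc.prems(3) by simp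
  finally have "\<not> {1..<r} \<subseteq> (\<lambda>x. snd (hd (\<theta> x))) ` set u"
    by (meson card_mono finite_imageI finite_set leD)
  then obtain c' where "c' \<in> {1..<r}" "c' \<notin> (\<lambda>x. snd (hd (\<theta> x))) ` set u" by blast
  then obtain c where c: "Suc c < r" "\<And>x. x \<in> set u \<Longrightarrow> snd (hd (\<theta> x)) \<noteq> Suc c"
    by (intro that[of "c' - 1"]) auto
  have iterated_block: "iterated_block r (Suc m) = block_word r (iterated_block r m)" by (simp add: iterated_block_def)
  \<comment> \<open>These variables would violate the nonemptiness assumption of the induction
    hypothesis, so they are removed first and restored by \<open>reducible_extend\<close>.\<close>
  define A where "A = {x \<in> set u. decode c (\<theta> x) = []}"
  have f: "filter (\<lambda>y. y \<notin> A) u = filter (\<lambda>y. decode c (\<theta> y) \<noteq> []) u"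
    by (auto simp: A_def intro: filter_cong)
  show ?case
  proof (rule reducible_extend[of A])
    show "finite A" by (simp add: A_def)
    have "sublist (decode c (concat (map \<theta> u))) (iterated_block r m)"
      using sublist_decode[OF Suc.prems(2), of c] decode_block_word[OF c(1)] by (simp add: iterated_block)
    then have "sublist (concat (map (\<lambda>x. decode c (\<theta> x)) (filter (\<lambda>y. y \<notin> A) u))) (iterated_block r m)"
      unfolding f concat_map_filter_empty using decode_concat[of u \<theta> c] c(2) Suc.prems(1) by simp
    moreover have "card (set (filter (\<lambda>y. y \<notin> A) u)) \<le> card (set u)"
      by (intro card_mono) auto
    ultimately show "reducible (filter (\<lambda>y. y \<notin> A) u)"
      using Suc.prems(3) by (intro Suc.IH[of _ "\<lambda>x. decode c (\<theta> x)"]) (auto simp: A_def)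
  next
    fix x mid assume x: "x \<in> A" "sublist (x # mid @ [x]) u"
    show "\<not> set mid \<subseteq> A"
    proof
      assume mid: "set mid \<subseteq> A"
      have "x \<in> set u" using x by (simp add: A_def)
      then obtain a t where at: "\<theta> x = a # t" using Suc.prems(1) by (cases "\<theta> x") auto
      \<comment> \<open>Cut off right after the first letter of the second copy of the image of
        \<open>x\<close>, so that both ends are the same letter and lie in the same column.\<close>
      let ?g = "a # (t @ concat (map \<theta> mid)) @ [a]"
      have g: "concat (map \<theta> (x # mid @ [x])) = ?g @ t" by (simp add: at)
      have "sublist ?g (concat (map \<theta> (x # mid @ [x])))"
        unfolding g by (rule prefix_imp_sublist) simp
      moreover have "sublist (concat (map \<theta> (x # mid @ [x]))) (block_word r (iterated_block r m))"
        using sublist_concat_map[OF x(2)] Suc.prems(2) unfolding iterated_block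
        by (rule sublist_order.order_trans)
      ultimately have "sublist ?g (block_word r (iterated_block r m))" by (rule sublist_order.order_trans)
      then have "decode c ?g \<noteq> []" using c(1) by (rule decode_repeated_column[OF _ refl])
      moreover have "decode c (concat (map \<theta> (x # mid @ [x]))) = []"
        using x mid c(2) Suc.prems(1)
        by (subst decode_concat) (auto simp: A_def)
      ultimately show False using decode_append_prefix[of c ?g t] unfolding g by auto
    qed
  qed
qed


section \<open>Reducible words are isoterms\<close>

definition eval :: "nat \<Rightarrow> (nat \<Rightarrow> 'a::field mat) \<Rightarrow> nat list \<Rightarrow> 'a mat" where
  "eval n \<rho> w = foldr (\<lambda>x A. \<rho> x * A) w (1\<^sub>m n)"

lemma eval_simps [simp]:
  "eval n \<rho> [] = 1\<^sub>m n"
  "eval n \<rho> (x # w) = \<rho> x * eval n \<rho> w"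
  by (simp_all add: eval_def)

lemma eval_carrier: "(\<And>x. \<rho> x \<in> carrier_mat n n) \<Longrightarrow> eval n \<rho> w \<in> carrier_mat n n"
  by (induction w) (auto intro: mult_carrier_mat)

lemma eval_mult_vec:
  assumes "\<And>x. \<rho> x \<in> carrier_mat n n" "v \<in> carrier_vec n"
  shows "eval n \<rho> w *\<^sub>v v = foldr (\<lambda>x v. \<rho> x *\<^sub>v v) w v"
proof (induction w)
  case (Cons x w)
  then show ?case
    using assms assoc_mult_mat_vec[OF assms(1) eval_carrier[OF assms(1)] assms(2)] by simp
qed (use assms in simp)

lemma eval_delete:
  assumes "\<And>z. \<rho> z \<in> carrier_mat n n"
  shows "eval n (\<rho>(x := 1\<^sub>m n)) w = eval n \<rho> (filter (\<lambda>y. y \<noteq> x) w)"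
  by (induction w) (simp_all add: left_mult_one_mat[OF eval_carrier[OF assms]])

text \<open>Unlike \<open>holds_in\<close>, this admits empty words, which arise when letters are
  deleted.\<close>

definition monoid_identity :: "nat \<Rightarrow> 'a::field itself \<Rightarrow> nat list \<Rightarrow> nat list \<Rightarrow> bool" where
  "monoid_identity n F u v \<longleftrightarrow>
     (\<forall>\<rho>. (\<forall>x. \<rho> x \<in> carrier (Upm11T n :: 'a mat monoid)) \<longrightarrow> eval n \<rho> u = eval n \<rho> v)"

lemma carrier_Upm11T_mat: "A \<in> carrier (Upm11T n :: 'a::field mat monoid) \<Longrightarrow> A \<in> carrier_mat n n"
  by (simp add: Upm11T_def)

lemma monoid_identity_delete:
  fixes F :: "'a::field itself"
  assumes "monoid_identity n F u v" "n \<ge> 1"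
  shows "monoid_identity n F (filter (\<lambda>y. y \<noteq> x) u) (filter (\<lambda>y. y \<noteq> x) v)"
  unfolding monoid_identity_def
proof (intro allI impI)
  fix \<rho> :: "nat \<Rightarrow> 'a mat" assume \<rho>: "\<forall>z. \<rho> z \<in> carrier (Upm11T n)"
  have "1\<^sub>m n \<in> carrier (Upm11T n :: 'a mat monoid)"
    using monoid.one_closed[OF monoid_Upm11T[OF assms(2), where 'a = 'a]] by (simp add: Upm11T_def)
  then have "eval n (\<rho>(x := 1\<^sub>m n)) u = eval n (\<rho>(x := 1\<^sub>m n)) v"
    using assms(1) \<rho> by (auto simp: monoid_identity_def)
  then show "eval n \<rho> (filter (\<lambda>y. y \<noteq> x) u) = eval n \<rho> (filter (\<lambda>y. y \<noteq> x) v)"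
    using \<rho> carrier_Upm11T_mat by (subst (asm) (1 2) eval_delete) auto
qed

text \<open>Send every letter to the matrix unit \<open>Z\<close>: a nonempty product then vanishes
  at index \<open>(1, 1)\<close>, whereas the empty product is the identity matrix.\<close>

lemma monoid_identity_Nil:
  fixes F :: "'a::field itself"
  assumes "monoid_identity n F [] v" "n \<ge> 2"
  shows "v = []"
proof (cases v)
  case (Cons x w)
  define Z :: "'a mat" where "Z = mat n n (\<lambda>(i, j). if i = 0 \<and> j = 0 then 1 else 0)"
  have Z: "Z \<in> carrier (Upm11T n)" using assms(2) by (auto simp: Z_def Upm11T_def)
  then have "eval n (\<lambda>_. Z) [] = eval n (\<lambda>_. Z) v"
    using assms(1) by (simp add: monoid_identity_def)
  then have e: "Z * eval n (\<lambda>_. Z) w = 1\<^sub>m n" unfolding Cons by simp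
  have "eval n (\<lambda>_. Z) w \<in> carrier_mat n n" using Z by (intro eval_carrier carrier_Upm11T_mat)
  then have "(Z * eval n (\<lambda>_. Z) w) $$ (1, 1) = row Z 1 \<bullet> col (eval n (\<lambda>_. Z) w) 1"
    using assms(2) by (subst index_mult_mat) (auto simp: Z_def)
  also have "row Z 1 = 0\<^sub>v n" using assms(2) by (auto simp: Z_def)
  also have "0\<^sub>v n \<bullet> col (eval n (\<lambda>_. Z) w) 1 = 0"
    using \<open>eval n (\<lambda>_. Z) w \<in> carrier_mat n n\<close> assms(2) by (intro scalar_prod_left_zero carrier_vecI) auto
  finally show ?thesis using e assms(2) by simp
qed

text \<open>The value of \<open>gap_head x w\<close> is 1, -1 or 0 according to whether the maximal power of \<open>x\<close>
  with which \<open>w\<close> begins has exponent 0, 1 or at least 2.\<close>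

fun gap_head :: "nat \<Rightarrow> nat list \<Rightarrow> 'a::field" where
  "gap_head x [] = 1"
| "gap_head x [z] = (if z = x then -1 else 1)"
| "gap_head x (z # y # w) = (if z = x then if y = x then 0 else -1 else 1)"

text \<open>One code per letter other than \<open>x\<close>, for the power of \<open>x\<close> right
  after it. The power at the beginning of the word is not included; \<open>gap_head x w\<close>
  covers it.\<close>

fun gaps :: "nat \<Rightarrow> nat list \<Rightarrow> 'a::field list" where
  "gaps x [] = []"
| "gaps x (z # w) = (if z = x then gaps x w else gap_head x w # gaps x w)"

lemma length_gaps: "length (gaps x w) = length (filter (\<lambda>y. y \<noteq> x) w)"
  by (induction w) auto

lemma gap_head_neq: "z \<noteq> x \<Longrightarrow> gap_head x (z # w) = 1"
  by (cases w) auto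

lemma gap_head_eq: "gap_head x (x # w) = (if w \<noteq> [] \<and> hd w = x then 0 else -1)"
  by (cases w) auto

text \<open>As \<open>2 \<noteq> 0\<close>, the codes 1, -1 and 0 are distinct. Since
  \<open>xx\<close> is not a factor of \<open>u\<close>, the code 0 does not occur, so the codes fix
  the exponents exactly, in \<open>v\<close> as well.\<close>

lemma eq_by_gaps:
  assumes "(2 :: 'a::field) \<noteq> 0"
    and "filter (\<lambda>y. y \<noteq> x) u = filter (\<lambda>y. y \<noteq> x) v"
    and "gap_head x u = (gap_head x v :: 'a)" "gaps x u = (gaps x v :: 'a list)"
    and "\<not> sublist [x, x] u"
  shows "u = v"
  using assms(2-)
proof (induction u arbitrary: v)
  case Nil
  then show ?case
    using assms(1) by (cases v) (auto simp: gap_head_eq split: if_splits)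
next
  case (Cons z u)
  have neg: "(1 :: 'a) \<noteq> -1" using assms(1) by (metis add.right_inverse one_add_one)
  have sub: "\<not> sublist [x, x] u" using Cons.prems(4) by (auto simp: sublist_Cons_right)
  show ?case
  proof (cases "z = x")
    case False
    then have "gap_head x v = (1 :: 'a)" using Cons.prems(2) gap_head_neq by metis
    then obtain z' v' where v: "v = z' # v'" "z' \<noteq> x"
      using Cons.prems(1) False neg by (cases v) (auto simp: gap_head_eq split: if_splits)
    then show ?thesis using Cons.IH[of v'] Cons.prems False sub by auto
  next
    case True
    have nx: "\<not> (u \<noteq> [] \<and> hd u = x)"
      using Cons.prems(4) True by (cases u) (auto simp: sublist_Cons_right)
    then have "gap_head x (z # u) = (-1 :: 'a)" using True by (auto simp: gap_head_eq)
    then have "gap_head x v = (-1 :: 'a)" using Cons.prems(2) by simp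
    then obtain v' where v: "v = x # v'" "\<not> (v' \<noteq> [] \<and> hd v' = x)"
      using neg by (cases v; cases "hd v = x") (auto simp: gap_head_neq gap_head_eq split: if_splits)
    have "gap_head x u = (1 :: 'a)" using nx by (cases u) (auto simp: gap_head_neq)
    moreover have "gap_head x v' = (1 :: 'a)" using v(2) by (cases v') (auto simp: gap_head_neq)
    ultimately show ?thesis using Cons.IH[of v'] Cons.prems True v sub by auto
  qed
qed

section \<open>Signed sums and independence of characters\<close>

fun signed_sum :: "(nat \<Rightarrow> 'a::field) \<Rightarrow> nat list \<Rightarrow> 'a list \<Rightarrow> 'a" where
  "signed_sum \<epsilon> (y # ys) (g # gs) = g + \<epsilon> y * signed_sum \<epsilon> ys gs"
| "signed_sum \<epsilon> _ _ = 0"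

text \<open>\<open>signed_sum\<close> is Horner's scheme, the form that the matrix products yield.
  Expanded, each gap code carries the sign of the prefix before its letter, a character in
  \<epsilon>.\<close>

lemma signed_sum_eq:
  "length ys = length gs \<Longrightarrow>
     signed_sum \<epsilon> ys gs = (\<Sum>i<length ys. gs ! i * prod_list (map \<epsilon> (take i ys)))"
  by (induction \<epsilon> ys gs rule: signed_sum.induct)
     (auto simp: sum.lessThan_Suc_shift sum_distrib_left algebra_simps simp del: sum.lessThan_Suc)

text \<open>Characters of an elementary abelian 2-group separate its points; instead of inverting the
  transform, flip the sign of one letter at a time.\<close>

lemma characters_independent:
  fixes c :: "'i \<Rightarrow> 'a::field" and p :: "'i \<Rightarrow> nat list"
  assumes "(2 :: 'a) \<noteq> 0" "finite L" "finite J"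
    and "\<And>i j. i \<in> J \<Longrightarrow> j \<in> J \<Longrightarrow> i \<noteq> j \<Longrightarrow>
           \<exists>z\<in>L. odd (count_list (p i) z) \<noteq> odd (count_list (p j) z)"
    and "\<And>\<epsilon>. range \<epsilon> \<subseteq> {1, -1} \<Longrightarrow> (\<Sum>i\<in>J. c i * prod_list (map \<epsilon> (p i))) = 0"
    and "i \<in> J"
  shows "c i = 0"
  using assms(2-)
proof (induction L arbitrary: J rule: finite_induct)
  case empty
  then have "J = {i}" by auto
  moreover have "prod_list (map (\<lambda>_. 1) w) = (1 :: 'a)" for w :: "nat list" by (induction w) auto
  ultimately show ?case using empty.prems(3)[of "\<lambda>_. 1"] by (simp add: image_subset_iff)
next
  case (insert z L)
  define K where "K b = {j \<in> J. odd (count_list (p j) z) = b}" for b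
  have "(\<Sum>j\<in>K b. c j * prod_list (map \<epsilon> (p j))) = 0" if \<epsilon>: "range \<epsilon> \<subseteq> {1, -1}" for b and \<epsilon> :: "nat \<Rightarrow> 'a"
  proof -
    let ?S = "\<lambda>b. \<Sum>j\<in>K b. c j * prod_list (map \<epsilon> (p j))"
    have J: "J = K True \<union> K False" "K True \<inter> K False = {}" "finite (K True)" "finite (K False)"
      using insert.prems(1) by (auto simp: K_def)
    \<comment> \<open>The flip negates exactly the terms in \<open>K True\<close>. The given
      relation and the flipped one thus yield the sum and the difference of the two partial sums,
      and as \<open>2 \<noteq> 0\<close> both partial sums vanish.\<close>
    have flip: "prod_list (map (\<epsilon>(z := - \<epsilon> z)) w) = (-1) ^ count_list w z * prod_list (map \<epsilon> w)" for w
      by (induction w) auto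
    have "range (\<epsilon>(z := - \<epsilon> z)) \<subseteq> {1, -1}" using \<epsilon> by (fastforce split: if_splits)
    then have "(\<Sum>i\<in>J. c i * prod_list (map (\<epsilon>(z := - \<epsilon> z)) (p i))) = 0" by (rule insert.prems(3))
    then have "(\<Sum>i\<in>K True. c i * prod_list (map (\<epsilon>(z := - \<epsilon> z)) (p i))) +
       (\<Sum>i\<in>K False. c i * prod_list (map (\<epsilon>(z := - \<epsilon> z)) (p i))) = 0"
      unfolding J(1) using J by (subst (asm) sum.union_disjoint) auto
    moreover have "(\<Sum>i\<in>K True. c i * prod_list (map (\<epsilon>(z := - \<epsilon> z)) (p i))) = - ?S True"
      unfolding flip sum_negf[symmetric] by (intro sum.cong) (auto simp: K_def)
    moreover have "(\<Sum>i\<in>K False. c i * prod_list (map (\<epsilon>(z := - \<epsilon> z)) (p i))) = ?S False"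
      unfolding flip by (intro sum.cong) (auto simp: K_def)
    ultimately have eq: "?S False = ?S True" by simp
    have "(\<Sum>i\<in>J. c i * prod_list (map \<epsilon> (p i))) = 0" using \<epsilon> by (rule insert.prems(3))
    then have "?S True + ?S False = 0"
      unfolding J(1) using J by (subst (asm) sum.union_disjoint) auto
    then have "2 * ?S True = 0" using eq by simp
    then have "?S True = 0" using assms(1) by simp
    then show ?thesis using eq by (cases b) auto
  qed
  note zero = this
  \<comment> \<open>All members of the half containing \<open>i\<close> agree in the parity of
    \<open>z\<close>, so the letters in \<open>L\<close> already separate them.\<close>
  show ?case
  proof (rule insert.IH[of "K (odd (count_list (p i) z))"])
    show "finite (K (odd (count_list (p i) z)))" using insert.prems(1) by (simp add: K_def)
    show "i \<in> K (odd (count_list (p i) z))" using insert.prems(4) by (simp add: K_def)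
    fix j k assume "j \<in> K (odd (count_list (p i) z))" "k \<in> K (odd (count_list (p i) z))" "j \<noteq> k"
    then show "\<exists>z\<in>L. odd (count_list (p j) z) \<noteq> odd (count_list (p k) z)"
      using insert.prems(2)[of j k] by (auto simp: K_def)
  qed (rule zero)
qed

text \<open>The differences of the codes are the coefficients of a linear relation between the sign
  characters of prefixes of \<open>ys\<close>. Two such prefixes differ by a nonempty factor of a
  reducible word, which has a letter of odd count, so the characters are distinct and the relation
  is trivial.\<close>

lemma gaps_unique:
  assumes "(2 :: 'a::field) \<noteq> 0" "reducible ys" "length gs = length ys" "length hs = length ys"
    and eq: "\<And>\<epsilon>. range \<epsilon> \<subseteq> {1, -1} \<Longrightarrow> signed_sum \<epsilon> ys gs = (signed_sum \<epsilon> ys hs :: 'a)"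
  shows "gs = hs"
proof -
  have sep: "\<exists>z\<in>set ys. odd (count_list (take i ys) z) \<noteq> odd (count_list (take j ys) z)"
    if "i < j" "j < length ys" for i j
  proof -
    have e: "take j ys = take i ys @ drop i (take j ys)"
      using that by (metis append_take_drop_id less_imp_le min.absorb1 take_take)
    have "sublist (drop i (take j ys)) ys"
      by (metis append_take_drop_id prefix_imp_sublist sublist_append_leftI sublist_order.order_trans
          take_is_prefix)
    moreover have "drop i (take j ys) \<noteq> []" using that by simp
    ultimately obtain z where z: "odd (count_list (drop i (take j ys)) z)"
      using reducible_odd_letter[OF assms(2)] by blast
    have "count_list (take j ys) z = count_list (take i ys) z + count_list (drop i (take j ys)) z"
      by (subst e) (rule count_list_append)
    then have "odd (count_list (take i ys) z) \<noteq> odd (count_list (take j ys) z)" using z by auto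
    moreover have "z \<in> set ys" using z in_set_dropD in_set_takeD
      by (metis count_list_0_iff even_zero)
    ultimately show ?thesis by blast
  qed
  have "gs ! i - hs ! i = 0" if "i < length ys" for i
  proof (rule characters_independent[where J = "{..<length ys}" and p = "\<lambda>i. take i ys" and L = "set ys"])
    fix i j assume "i \<in> {..<length ys}" "j \<in> {..<length ys}" "i \<noteq> j"
    then show "\<exists>z\<in>set ys. odd (count_list (take i ys) z) \<noteq> odd (count_list (take j ys) z)"
      using sep[of i j] sep[of j i] by (cases "i < j") auto
  next
    fix \<epsilon> :: "nat \<Rightarrow> 'a" assume "range \<epsilon> \<subseteq> {1, -1}"
    from eq[OF this]
    show "(\<Sum>i<length ys. (gs ! i - hs ! i) * prod_list (map \<epsilon> (take i ys))) = 0"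
      using assms(3,4) by (simp add: signed_sum_eq left_diff_distrib sum_subtractf)
  qed (use that assms(1) in auto)
  then show ?thesis using assms(3,4) by (intro nth_equalityI) auto
qed

text \<open>Words act from right to left. Coordinate \<open>a\<close> accumulates the signed sum,
  \<open>b\<close> is the code of the power of \<open>x\<close> at the front of the part read so
  far, and \<open>d\<close> is what \<open>b\<close> becomes if another \<open>x\<close> is read.
  The constant 1 serves to reset \<open>b\<close> and \<open>d\<close>.\<close>

definition state :: "nat \<Rightarrow> 'a \<Rightarrow> 'a \<Rightarrow> 'a \<Rightarrow> 'a::field vec" where
  "state n a b d = vec n (\<lambda>i. if i = 0 then a else if i = 1 then b else if i = 2 then d
     else if i = 3 then 1 else 0)"

text \<open>In a product of these matrices, a path from 1 to 4 (in the paper's indexing) leaves 1 at some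
  letter other than \<open>x\<close>, contributing the sign of the prefix read so far, and then measures the
  power of \<open>x\<close> up to the next such letter with the weights of \<open>gap_head\<close>. The vector
  \<open>state n 0 1 (-1)\<close> acts like one more such letter at the end of the word.\<close>

definition probe :: "nat \<Rightarrow> (nat \<Rightarrow> 'a::field) \<Rightarrow> nat \<Rightarrow> nat \<Rightarrow> 'a mat" where
  "probe n \<epsilon> x z = mat n n (\<lambda>(i, j).
     if z = x then if (i, j) \<in> {(0, 0), (1, 2), (3, 3)} then 1 else 0
     else if (i, j) = (0, 0) then \<epsilon> z
     else if (i, j) \<in> {(0, 1), (1, 3), (3, 3)} then 1
     else if (i, j) = (2, 3) then -1 else 0)"

lemma probe_carrier:
  assumes "range \<epsilon> \<subseteq> {1, -1}" "n \<ge> 1"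
  shows "probe n \<epsilon> x z \<in> carrier (Upm11T n)"
proof -
  have "\<epsilon> z \<in> {1, -1}" using assms by auto
  then show ?thesis using assms(2) by (auto simp: probe_def Upm11T_def)
qed

lemma probe_state:
  assumes "n \<ge> 4"
  shows "probe n \<epsilon> x z *\<^sub>v state n a b d =
    (if z = x then state n a d 0 else state n (\<epsilon> z * a + b) 1 (-1))"
proof (rule eq_vecI)
  fix i assume i: "i < dim_vec (if z = x then state n a d 0 else state n (\<epsilon> z * a + b) 1 (-1))"
  then have i: "i < n" by (simp add: state_def split: if_splits)
  let ?f = "\<lambda>j. probe n \<epsilon> x z $$ (i, j) * state n a b d $ j"
  have "(probe n \<epsilon> x z *\<^sub>v state n a b d) $ i = (\<Sum>j<n. ?f j)"
    using i by (auto simp: probe_def state_def scalar_prod_def atLeast0LessThan intro!: sum.cong)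
  also have "\<dots> = (\<Sum>j<4. ?f j)"
    using assms by (intro sum.mono_neutral_right) (auto simp: state_def)
  also have "\<dots> = ?f 0 + ?f 1 + ?f 2 + ?f 3" by (simp add: eval_nat_numeral)
  also have "\<dots> = (if z = x then state n a d 0 else state n (\<epsilon> z * a + b) 1 (-1)) $ i"
    using assms i by (auto simp: probe_def state_def)
  finally show "(probe n \<epsilon> x z *\<^sub>v state n a b d) $ i =
    (if z = x then state n a d 0 else state n (\<epsilon> z * a + b) 1 (-1)) $ i" .
qed (auto simp: probe_def state_def)

text \<open>A letter other than \<open>x\<close> performs one Horner step with the current code and
  resets it; a letter \<open>x\<close> moves the code along 1, -1, 0.\<close>

lemma probe_word:
  assumes "n \<ge> 4"
  shows "foldr (\<lambda>z v. probe n \<epsilon> x z *\<^sub>v v) w (state n 0 1 (-1)) =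
    state n (signed_sum \<epsilon> (filter (\<lambda>y. y \<noteq> x) w) (gaps x w)) (gap_head x w)
      (if w \<noteq> [] \<and> hd w = x then 0 else -1)"
proof (induction w)
  case (Cons z w)
  then show ?case
    by (cases "z = x") (simp_all add: probe_state[OF assms] gap_head_eq gap_head_neq add.commute)
qed simp

text \<open>The induction hypothesis identifies \<open>u\<close> and \<open>v\<close> after deletion
  of \<open>x\<close>. The probes give equal signed sums for all choices of signs, hence equal gap
  codes, and these put \<open>x\<close> back in the same places.\<close>

lemma reducible_isoterm:
  fixes F :: "'a::field itself"
  assumes "reducible u" "monoid_identity n F u v" "n \<ge> 4" "(2 :: 'a) \<noteq> 0"
  shows "u = v"
  using assms(1,2)
proof (induction arbitrary: v rule: reducible.induct)
  case Nil
  then show ?case using monoid_identity_Nil assms(3) by force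
next
  case (delete x u)
  let ?ys = "filter (\<lambda>y. y \<noteq> x) u"
  have fil: "?ys = filter (\<lambda>y. y \<noteq> x) v"
    using monoid_identity_delete[OF delete.prems] assms(3) by (intro delete.IH) auto
  have st: "signed_sum \<epsilon> ?ys (gaps x u) = signed_sum \<epsilon> ?ys (gaps x v) \<and> gap_head x u = (gap_head x v :: 'a)"
    if "range \<epsilon> \<subseteq> {1, -1}" for \<epsilon> :: "nat \<Rightarrow> 'a"
  proof -
    let ?d = "\<lambda>w. if w \<noteq> [] \<and> hd w = x then 0 else -1 :: 'a"
    let ?s = "\<lambda>w. state n (signed_sum \<epsilon> (filter (\<lambda>y. y \<noteq> x) w) (gaps x w)) (gap_head x w) (?d w)"
    have c: "probe n \<epsilon> x z \<in> carrier (Upm11T n)" for z using that assms(3) by (intro probe_carrier) auto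
    then have ev: "eval n (probe n \<epsilon> x) u = eval n (probe n \<epsilon> x) v"
      using delete.prems by (auto simp: monoid_identity_def)
    have pw: "eval n (probe n \<epsilon> x) w *\<^sub>v state n 0 1 (-1) = ?s w" for w
      using carrier_Upm11T_mat[OF c]
      by (subst eval_mult_vec) (auto simp: probe_word[OF assms(3)], simp add: state_def)
    have "?s u = ?s v" unfolding pw[symmetric] ev ..
    then have "?s u $ i = ?s v $ i" for i by simp
    from this[of 0] this[of 1] show ?thesis using assms(3) by (simp add: state_def fil)
  qed
  have "gaps x u = (gaps x v :: 'a list)"
    using assms(4) delete.hyps(1) st fil
    by (intro gaps_unique[of ?ys]) (simp_all add: length_gaps)
  moreover have "gap_head x u = (gap_head x v :: 'a)" using st[of "\<lambda>_. 1"] by auto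
  ultimately show ?case using eq_by_gaps[OF assms(4) fil] delete.hyps(2) by blast
qed


section \<open>Identities and varieties\<close>

fun word_value :: "'a sgrp \<Rightarrow> (nat \<Rightarrow> 'a) \<Rightarrow> nat list \<Rightarrow> 'a" where
  "word_value S \<rho> [x] = \<rho> x"
| "word_value S \<rho> (x # y # w) = sprod S (\<rho> x) (word_value S \<rho> (y # w))"
| "word_value S \<rho> [] = undefined"

lemma word_value_Cons:
  "w \<noteq> [] \<Longrightarrow> word_value S \<rho> (x # w) = sprod S (\<rho> x) (word_value S \<rho> w)"
  by (cases w) auto

lemma sprod_closed:
  "is_semigroup S \<Longrightarrow> x \<in> carrier S \<Longrightarrow> y \<in> carrier S \<Longrightarrow> sprod S x y \<in> carrier S"
  by (simp add: is_semigroup_def)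

lemma sprod_assoc:
  "is_semigroup S \<Longrightarrow> x \<in> carrier S \<Longrightarrow> y \<in> carrier S \<Longrightarrow> z \<in> carrier S \<Longrightarrow>
    sprod S (sprod S x y) z = sprod S x (sprod S y z)"
  by (simp add: is_semigroup_def)

lemma word_value_closed:
  assumes "is_semigroup S" "\<And>x. \<rho> x \<in> carrier S" "w \<noteq> []"
  shows "word_value S \<rho> w \<in> carrier S"
  using assms(3) by (induction w rule: induct_list012) (auto intro: sprod_closed assms)

lemma word_value_append:
  assumes "is_semigroup S" "\<And>x. \<rho> x \<in> carrier S" "w \<noteq> []" "v \<noteq> []"
  shows "word_value S \<rho> (w @ v) = sprod S (word_value S \<rho> w) (word_value S \<rho> v)"
  using assms(3)
proof (induction w rule: induct_list012)
  case (3 x y w)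
  then show ?case
    using sprod_assoc[OF assms(1,2) word_value_closed[OF assms(1,2)] word_value_closed[OF assms(1,2)]]
      assms(4) by auto
qed (auto simp: word_value_Cons assms)

lemma word_value_cong:
  "(\<And>x. x \<in> set w \<Longrightarrow> \<rho> x = \<sigma> x) \<Longrightarrow> word_value S \<rho> w = word_value S \<sigma> w"
  by (induction w rule: induct_list012) auto

lemma morphism_word_value:
  assumes "\<phi> \<in> sgrp_morphisms free_sgrp S" "w \<noteq> []"
  shows "\<phi> w = word_value S (\<lambda>x. \<phi> [x]) w"
  using assms(2)
proof (induction w rule: induct_list012)
  case (3 x y w)
  have "\<phi> ([x] @ y # w) = sprod S (\<phi> [x]) (\<phi> (y # w))"
    using assms(1) by (auto simp: sgrp_morphisms_def free_sgrp_def simp del: append_Cons append.simps)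
  then show ?case using 3 by simp
qed auto

lemma holds_in_iff:
  assumes "is_semigroup S" "u \<noteq> []" "v \<noteq> []"
  shows "holds_in (u, v) S \<longleftrightarrow>
    (\<forall>\<rho>. (\<forall>x. \<rho> x \<in> carrier S) \<longrightarrow> word_value S \<rho> u = word_value S \<rho> v)"
proof (intro iffI allI impI)
  fix \<rho> :: "nat \<Rightarrow> 'a" assume h: "holds_in (u, v) S" and \<rho>: "\<forall>x. \<rho> x \<in> carrier S"
  then have "word_value S \<rho> \<in> sgrp_morphisms free_sgrp S"
    using assms(1) by (auto simp: sgrp_morphisms_def free_sgrp_def word_value_closed word_value_append)
  then show "word_value S \<rho> u = word_value S \<rho> v" using h by (auto simp: holds_in_def)
next
  assume r: "\<forall>\<rho>. (\<forall>x. \<rho> x \<in> carrier S) \<longrightarrow> word_value S \<rho> u = word_value S \<rho> v"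
  show "holds_in (u, v) S"
    unfolding holds_in_def
  proof
    fix \<phi> assume \<phi>: "\<phi> \<in> sgrp_morphisms free_sgrp S"
    then have "\<forall>x. \<phi> [x] \<in> carrier S" by (auto simp: sgrp_morphisms_def free_sgrp_def)
    then have "word_value S (\<lambda>x. \<phi> [x]) u = word_value S (\<lambda>x. \<phi> [x]) v"
      using r by simp
    then show "\<phi> (fst (u, v)) = \<phi> (snd (u, v))"
      unfolding fst_conv snd_conv morphism_word_value[OF \<phi> assms(2)] morphism_word_value[OF \<phi> assms(3)] .
  qed
qed

section \<open>Isomorphic copies over another type\<close>

definition copy_sgrp :: "('a \<Rightarrow> 'b) \<Rightarrow> 'a sgrp \<Rightarrow> 'b sgrp" where
  "copy_sgrp f S = \<lparr>carrier = f ` carrier S,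
     sprod = \<lambda>x y. f (sprod S (inv_into (carrier S) f x) (inv_into (carrier S) f y))\<rparr>"

lemma copy_sgrp_simps [simp]:
  "carrier (copy_sgrp f S) = f ` carrier S"
  "inj_on f (carrier S) \<Longrightarrow> x \<in> carrier S \<Longrightarrow> y \<in> carrier S \<Longrightarrow>
     sprod (copy_sgrp f S) (f x) (f y) = f (sprod S x y)"
  by (auto simp: copy_sgrp_def)

lemma is_semigroup_copy:
  assumes "is_semigroup S" "inj_on f (carrier S)"
  shows "is_semigroup (copy_sgrp f S)"
  using assms unfolding is_semigroup_def by auto

lemma word_value_copy:
  assumes "is_semigroup S" "inj_on f (carrier S)" "\<And>x. \<rho> x \<in> carrier S" "w \<noteq> []"
  shows "word_value (copy_sgrp f S) (\<lambda>x. f (\<rho> x)) w = f (word_value S \<rho> w)"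
  using assms(4)
  by (induction w rule: induct_list012) (auto simp: assms word_value_closed)

text \<open>This brings the matrix monoid and the semigroup of factors into varieties over the
  universe type.\<close>

lemma holds_in_copy:
  assumes "is_semigroup S" "inj_on f (carrier S)" "u \<noteq> []" "v \<noteq> []"
  shows "holds_in (u, v) (copy_sgrp f S) \<longleftrightarrow> holds_in (u, v) S"
  unfolding holds_in_iff[OF assms(1,3,4)] holds_in_iff[OF is_semigroup_copy[OF assms(1,2)] assms(3,4)]
proof (intro iffI allI impI)
  fix \<rho> :: "nat \<Rightarrow> 'a"
  assume h: "\<forall>\<rho>. (\<forall>x. \<rho> x \<in> carrier (copy_sgrp f S)) \<longrightarrow>
    word_value (copy_sgrp f S) \<rho> u = word_value (copy_sgrp f S) \<rho> v"
    and \<rho>: "\<forall>x. \<rho> x \<in> carrier S"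
  have "word_value (copy_sgrp f S) (\<lambda>x. f (\<rho> x)) u = word_value (copy_sgrp f S) (\<lambda>x. f (\<rho> x)) v"
    using h \<rho> by simp
  then have "f (word_value S \<rho> u) = f (word_value S \<rho> v)"
    using word_value_copy[OF assms(1,2)] \<rho> assms(3,4) by simp
  then show "word_value S \<rho> u = word_value S \<rho> v"
    using \<rho> by (intro inj_onD[OF assms(2)] word_value_closed assms) auto
next
  fix \<rho> :: "nat \<Rightarrow> 'b"
  assume h: "\<forall>\<rho>. (\<forall>x. \<rho> x \<in> carrier S) \<longrightarrow> word_value S \<rho> u = word_value S \<rho> v"
    and \<rho>: "\<forall>x. \<rho> x \<in> carrier (copy_sgrp f S)"
  define \<sigma> where "\<sigma> x = inv_into (carrier S) f (\<rho> x)" for x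
  have \<sigma>: "\<rho> = (\<lambda>x. f (\<sigma> x))" "\<And>x. \<sigma> x \<in> carrier S"
    using \<rho> by (auto simp: \<sigma>_def f_inv_into_f inv_into_into)
  show "word_value (copy_sgrp f S) \<rho> u = word_value (copy_sgrp f S) \<rho> v"
    using h \<sigma>(2) unfolding \<sigma>(1)
    by (simp add: word_value_copy[OF assms(1,2)] assms(3,4))
qed

lemma sgrp_generated_closed:
  assumes "is_semigroup S" "X \<subseteq> carrier S"
  shows "sgrp_generated S X \<subseteq> carrier S"
proof
  fix x assume "x \<in> sgrp_generated S X"
  then show "x \<in> carrier S" by induction (use assms in \<open>auto intro: sprod_closed\<close>)
qed

lemma finitely_generated_copy:
  assumes "is_semigroup S" "inj_on f (carrier S)" "finitely_generated S"
  shows "finitely_generated (copy_sgrp f S)"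
proof -
  obtain X where X: "finite X" "X \<subseteq> carrier S" "sgrp_generated S X = carrier S"
    using assms(3) by (auto simp: finitely_generated_def)
  have "f x \<in> sgrp_generated (copy_sgrp f S) (f ` X)" if "x \<in> sgrp_generated S X" for x
    using that
  proof induction
    case (prod x y)
    have "sprod (copy_sgrp f S) (f x) (f y) = f (sprod S x y)"
      using prod X assms(2) by (intro copy_sgrp_simps) auto
    then show ?case using sgrp_generated.prod[OF prod.IH] by simp
  qed (auto intro: sgrp_generated.incl)
  moreover have "sgrp_generated (copy_sgrp f S) (f ` X) \<subseteq> carrier (copy_sgrp f S)"
    using X(2) by (intro sgrp_generated_closed is_semigroup_copy assms) auto
  ultimately have "sgrp_generated (copy_sgrp f S) (f ` X) = carrier (copy_sgrp f S)"
    using X(3) by auto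
  then show ?thesis
    using X(1,2) unfolding finitely_generated_def by (intro exI[of _ "f ` X"]) auto
qed

lemma inj_on_into_infinite:
  assumes "countable C" "infinite (UNIV :: 'u set)"
  shows "\<exists>f :: 'a \<Rightarrow> 'u. inj_on f C"
proof -
  obtain g :: "nat \<Rightarrow> 'u" where "inj g" using infinite_countable_subset[OF assms(2)] by auto
  moreover obtain h :: "'a \<Rightarrow> nat" where "inj_on h C" using assms(1) by (auto simp: countable_def)
  ultimately have "inj_on (g \<circ> h) C" by (auto intro: comp_inj_on inj_on_subset)
  then show ?thesis by blast
qed

section \<open>Local finiteness of the generated variety\<close>

lemma sgrp_generated_word_value:
  assumes "is_semigroup S" "\<And>x. \<rho> x \<in> carrier S" "s \<in> sgrp_generated S (\<rho> ` Y)"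
  shows "\<exists>w. w \<noteq> [] \<and> set w \<subseteq> Y \<and> s = word_value S \<rho> w"
  using assms(3)
proof induction
  case (incl s)
  then obtain y where "y \<in> Y" "s = \<rho> y" by auto
  then show ?case by (intro exI[of _ "[y]"]) auto
next
  case (prod s t)
  then obtain w v where "w \<noteq> []" "set w \<subseteq> Y" "s = word_value S \<rho> w"
    "v \<noteq> []" "set v \<subseteq> Y" "t = word_value S \<rho> v" by auto
  then show ?case
    by (intro exI[of _ "w @ v"]) (simp add: word_value_append[OF assms(1,2)])
qed

lemma finite_image_factor:
  assumes "finite (F ` W)" "\<And>w v. w \<in> W \<Longrightarrow> v \<in> W \<Longrightarrow> F w = F v \<Longrightarrow> H w = H v"
  shows "finite (H ` W)"
proof (rule finite_surj[OF assms(1)])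
  show "H ` W \<subseteq> (\<lambda>y. H (inv_into W F y)) ` F ` W"
  proof
    fix h assume "h \<in> H ` W"
    then obtain w where w: "w \<in> W" "h = H w" by auto
    then have "H w = H (inv_into W F (F w))"
      by (intro assms(2)) (auto intro: inv_into_into simp: f_inv_into_f)
    then show "h \<in> (\<lambda>y. H (inv_into W F y)) ` F ` W" using w by blast
  qed
qed

text \<open>Words in \<open>m\<close> letters induce maps from the finitely many assignments in
  \<open>S\<close> to \<open>S\<close>, and there are only finitely many such maps. Words inducing
  the same map form an identity of \<open>S\<close>, so they have the same value in
  \<open>T\<close>.\<close>

lemma locally_finite_var_generated:
  assumes "is_semigroup S" "finite (carrier S)"
  shows "locally_finite (var_generated S)"
  unfolding locally_finite_def
proof (intro ballI impI)
  fix T :: "'b sgrp" assume T: "T \<in> var_generated S" and "finitely_generated T"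
  then obtain X where X: "finite X" "X \<subseteq> carrier T" "sgrp_generated T X = carrier T"
    by (auto simp: finitely_generated_def)
  have semi: "is_semigroup T" using T by (simp add: var_generated_def models_def)
  have "X \<noteq> {}"
  proof
    assume "X = {}"
    moreover have "x \<notin> sgrp_generated T {}" for x
      by (rule notI, induction rule: sgrp_generated.induct) auto
    ultimately show False using X semi by (auto simp: is_semigroup_def)
  qed
  obtain x0 where x0: "x0 \<in> X" using \<open>X \<noteq> {}\<close> by blast
  obtain m and g :: "nat \<Rightarrow> 'b" where g: "X = g ` {..<m}"
    using X(1) by (metis finite_imp_nat_seg_image_inj_on lessThan_def)
  \<comment> \<open>Assignments are total on the variables; indices from \<open>m\<close> on get the
    generator \<open>x0\<close> as a default.\<close>
  define \<rho> where "\<rho> i = (if i < m then g i else x0)" for i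
  have \<rho>: "\<rho> i \<in> carrier T" for i using x0 X(2) g by (auto simp: \<rho>_def)
  have X': "X = \<rho> ` {..<m}" using g by (auto simp: \<rho>_def)
  define W where "W = {w. w \<noteq> [] \<and> set w \<subseteq> {..<m}}"
  define A where "A = {..<m} \<rightarrow>\<^sub>E carrier S"
  obtain s0 where s0: "s0 \<in> carrier S" using assms(1) by (auto simp: is_semigroup_def)
  define ext where "ext \<sigma> i = (if i < m then \<sigma> i else s0)" for \<sigma> i
  have ext: "ext \<sigma> i \<in> carrier S" if "\<sigma> \<in> A" for \<sigma> i
    using that s0 by (auto simp: ext_def A_def)
  define F where "F w = restrict (\<lambda>\<sigma>. word_value S (ext \<sigma>) w) A" for w
  have "F ` W \<subseteq> A \<rightarrow>\<^sub>E carrier S"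
    using ext assms(1) by (auto simp: F_def W_def intro!: word_value_closed)
  moreover have "finite (A \<rightarrow>\<^sub>E carrier S)"
    unfolding A_def using assms(2) by (intro finite_PiE) auto
  ultimately have "finite (F ` W)" by (rule finite_subset)
  then have "finite (word_value T \<rho> ` W)"
  proof (rule finite_image_factor)
    fix w v assume wv: "w \<in> W" "v \<in> W" "F w = F v"
    then have ne: "w \<noteq> []" "v \<noteq> []" by (auto simp: W_def)
    have "word_value S \<sigma> w = word_value S \<sigma> v" if \<sigma>: "\<forall>x. \<sigma> x \<in> carrier S" for \<sigma>
    proof -
      let ?\<sigma> = "restrict \<sigma> {..<m}"
      have "?\<sigma> \<in> A" using \<sigma> by (auto simp: A_def)
      then have "word_value S (ext ?\<sigma>) w = word_value S (ext ?\<sigma>) v"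
        using fun_cong[OF wv(3), of ?\<sigma>] by (simp add: F_def)
      moreover have "word_value S (ext ?\<sigma>) z = word_value S \<sigma> z" if "z \<in> W" for z
        using that by (intro word_value_cong) (auto simp: ext_def W_def)
      ultimately show ?thesis using wv by simp
    qed
    then have "holds_in (w, v) S" using holds_in_iff[OF assms(1) ne] by blast
    then have "holds_in (w, v) T"
      using T ne by (auto simp: var_generated_def models_def identities_def free_sgrp_def)
    then show "word_value T \<rho> w = word_value T \<rho> v" using holds_in_iff[OF semi ne] \<rho> by blast
  qed
  moreover have "carrier T \<subseteq> word_value T \<rho> ` W"
  proof
    fix s assume "s \<in> carrier T"
    then have "s \<in> sgrp_generated T (\<rho> ` {..<m})" using X(3) X' by simp
    from sgrp_generated_word_value[OF semi \<rho> this] show "s \<in> word_value T \<rho> ` W"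
      by (auto simp: W_def)
  qed
  ultimately show "finite (carrier T)" by (rule finite_subset[rotated])
qed

section \<open>The semigroup of factors\<close>

definition factors :: "nat \<Rightarrow> (nat \<times> nat) list set" where
  "factors r = {w. w \<noteq> [] \<and> (\<exists>m. sublist w (iterated_block r m))}"

text \<open>The empty word serves as the zero element.\<close>

definition factor_sgrp :: "nat \<Rightarrow> (nat \<times> nat) list sgrp" where
  "factor_sgrp r = \<lparr>carrier = insert [] (factors r),
     sprod = \<lambda>a b. if a \<noteq> [] \<and> b \<noteq> [] \<and> a @ b \<in> factors r then a @ b else []\<rparr>"

lemma factors_sublist: "w \<in> factors r \<Longrightarrow> sublist v w \<Longrightarrow> v \<noteq> [] \<Longrightarrow> v \<in> factors r"
  unfolding factors_def using sublist_order.order_trans by blast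

lemma factors_append:
  assumes "a @ b \<in> factors r"
  shows "a \<noteq> [] \<Longrightarrow> a \<in> factors r" "b \<noteq> [] \<Longrightarrow> b \<in> factors r"
  using factors_sublist[OF assms] by auto

text \<open>Both bracketings agree with the ternary product \<open>?t\<close>, because
  \<open>a @ b\<close> and \<open>b @ c\<close> are factors whenever \<open>a @ b @ c\<close> is
  one.\<close>

lemma is_semigroup_factor_sgrp: "is_semigroup (factor_sgrp r)"
proof -
  let ?p = "sprod (factor_sgrp r)"
  let ?t = "\<lambda>a b c. if a \<noteq> [] \<and> b \<noteq> [] \<and> c \<noteq> [] \<and> a @ b @ c \<in> factors r then a @ b @ c else []"
  have "?p (?p a b) c = ?t a b c" for a b c
    using factors_append(1)[of "a @ b" c r] by (auto simp: factor_sgrp_def)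
  moreover have "?p a (?p b c) = ?t a b c" for a b c
    using factors_append(2)[of a "b @ c" r] by (auto simp: factor_sgrp_def)
  moreover have "?p a b \<in> carrier (factor_sgrp r)" for a b
    by (simp add: factor_sgrp_def)
  moreover have "carrier (factor_sgrp r) \<noteq> {}" by (simp add: factor_sgrp_def)
  ultimately show ?thesis by (simp add: is_semigroup_def)
qed

lemma iterated_block_letters: "r \<ge> 1 \<Longrightarrow> set (iterated_block r m) \<subseteq> {..<r} \<times> {..<r}"
proof (induction m)
  case (Suc m)
  then show ?case
    by (fastforce simp: iterated_block_def block_word_def block_def)
qed (simp add: iterated_block_def)

text \<open>The zero and the one-letter factors generate: a longer factor is its first letter times
  a shorter factor. The alphabet is finite.\<close>

lemma finitely_generated_factor_sgrp:
  assumes "r \<ge> 1"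
  shows "finitely_generated (factor_sgrp r)"
proof -
  let ?S = "factor_sgrp r"
  define X where "X = {w \<in> carrier ?S. length w \<le> 1}"
  have letters: "set w \<subseteq> {..<r} \<times> {..<r}" if "w \<in> factors r" for w
    using that iterated_block_letters[OF assms] set_mono_sublist by (fastforce simp: factors_def)
  have "X \<subseteq> {w. set w \<subseteq> {..<r} \<times> {..<r} \<and> length w \<le> 1}"
    using letters by (auto simp: X_def factor_sgrp_def)
  then have "finite X" by (rule finite_subset) (intro finite_lists_length_le, auto)
  moreover have "X \<subseteq> carrier ?S" by (auto simp: X_def)
  moreover have "w \<in> sgrp_generated ?S X" if "w \<in> carrier ?S" for w
    using that
  proof (induction w rule: induct_list012)
    case (3 a b w)
    then have f: "[a] @ b # w \<in> factors r" by (simp add: factor_sgrp_def)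
    then have "[a] \<in> carrier ?S" "b # w \<in> carrier ?S"
      using factors_append[OF f] by (auto simp: factor_sgrp_def)
    then have "sprod ?S [a] (b # w) \<in> sgrp_generated ?S X"
      using 3 by (intro sgrp_generated.prod) (auto intro: sgrp_generated.incl simp: X_def)
    then show ?case using f by (simp add: factor_sgrp_def)
  qed (auto intro: sgrp_generated.incl simp: X_def)
  ultimately show ?thesis
    using sgrp_generated_closed[OF is_semigroup_factor_sgrp, of X r]
    unfolding finitely_generated_def by blast
qed

lemma length_iterated_block: "length (iterated_block r m) = r ^ m"
  by (induction m) (auto simp: iterated_block_def length_block_word)

lemma infinite_factors:
  assumes "r \<ge> 2"
  shows "infinite (factors r)"
proof
  assume "finite (factors r)"
  moreover have "iterated_block r m \<in> factors r" for m
  proof -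
    have "length (iterated_block r m) > 0" using assms by (simp add: length_iterated_block)
    then show ?thesis by (auto simp: factors_def)
  qed
  ultimately have "finite (range (iterated_block r))" by (meson finite_subset image_subsetI)
  moreover have "inj (iterated_block r)"
  proof (rule injI)
    fix m k assume "iterated_block r m = iterated_block r k"
    then have "r ^ m = r ^ k" using length_iterated_block by metis
    then show "m = k" using assms by simp
  qed
  ultimately show False using finite_imageD infinite_UNIV_nat by blast
qed

text \<open>A product with the zero stays zero, so a nonzero value means that every partial product
  was plain concatenation.\<close>

lemma word_value_factor_sgrp:
  assumes "w \<noteq> []" "word_value (factor_sgrp r) \<theta> w \<noteq> []" "\<And>x. \<theta> x \<in> carrier (factor_sgrp r)"
  shows "word_value (factor_sgrp r) \<theta> w = concat (map \<theta> w) \<and> concat (map \<theta> w) \<in> factors r \<and>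
    (\<forall>x\<in>set w. \<theta> x \<noteq> [])"
  using assms(1,2)
proof (induction w rule: induct_list012)
  case (2 x)
  then show ?case using assms(3)[of x] by (auto simp: factor_sgrp_def)
next
  case (3 x y w)
  then have "\<theta> x \<noteq> []" "word_value (factor_sgrp r) \<theta> (y # w) \<noteq> []"
    "\<theta> x @ word_value (factor_sgrp r) \<theta> (y # w) \<in> factors r"
    by (auto simp: factor_sgrp_def split: if_splits)
  then show ?case using 3 by (auto simp: factor_sgrp_def)
qed simp

text \<open>If some substitution gives one side a nonzero value, that side has an instance among the
  factors and is reducible, so \<open>iso\<close> yields \<open>u = v\<close>. Otherwise both sides
  are always zero.\<close>

lemma factor_sgrp_identity:
  assumes iso: "\<And>w w'. reducible w \<Longrightarrow> w \<in> {u, v} \<Longrightarrow> w' \<in> {u, v} \<Longrightarrow> w = w'"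
    and "u \<noteq> []" "v \<noteq> []" "card (set u) + 2 \<le> r" "card (set v) + 2 \<le> r"
  shows "holds_in (u, v) (factor_sgrp r)"
proof -
  let ?v = "word_value (factor_sgrp r)"
  have red: "reducible w"
    if "w \<in> {u, v}" "?v \<theta> w \<noteq> []" "\<forall>x. \<theta> x \<in> carrier (factor_sgrp r)" for w \<theta>
  proof -
    have "w \<noteq> []" "card (set w) + 2 \<le> r" using that(1) assms(2-) by auto
    moreover from this have "concat (map \<theta> w) \<in> factors r \<and> (\<forall>x\<in>set w. \<theta> x \<noteq> [])"
      using word_value_factor_sgrp[OF _ that(2)] that(3) by blast
    then obtain m where "sublist (concat (map \<theta> w)) (iterated_block r m)" "\<forall>x\<in>set w. \<theta> x \<noteq> []"
      by (auto simp: factors_def)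
    ultimately show ?thesis using encountered_reducible[of w \<theta> r m] by blast
  qed
  show ?thesis
    unfolding holds_in_iff[OF is_semigroup_factor_sgrp assms(2,3)]
  proof (intro allI impI)
    fix \<theta> :: "nat \<Rightarrow> (nat \<times> nat) list" assume \<theta>: "\<forall>x. \<theta> x \<in> carrier (factor_sgrp r)"
    show "?v \<theta> u = ?v \<theta> v"
    proof (cases "?v \<theta> u = [] \<and> ?v \<theta> v = []")
      case False
      then have "reducible u \<or> reducible v" using red \<theta> by blast
      then have "u = v" using iso[of u v] iso[of v u] by auto
      then show ?thesis by simp
    qed simp
  qed
qed

section \<open>Evaluation in the matrix monoid\<close>

lemma word_value_eval:
  assumes "\<And>x. \<rho> x \<in> carrier_mat n n" "w \<noteq> []"
  shows "word_value (semigroup_reduct (Upm11T n)) \<rho> w = eval n \<rho> w"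
  using assms(2)
proof (induction w rule: induct_list012)
  case (2 x)
  then show ?case using right_mult_one_mat[OF assms(1)] by simp
next
  case (3 x y w)
  then show ?case by (simp add: semigroup_reduct_def Upm11T_def)
qed simp

lemma holds_in_monoid_identity:
  fixes F :: "'a::field itself"
  assumes "holds_in (u, v) (semigroup_reduct (Upm11T n :: 'a mat monoid))" "u \<noteq> []" "v \<noteq> []" "n \<ge> 1"
  shows "monoid_identity n F u v"
  unfolding monoid_identity_def
proof (intro allI impI)
  fix \<rho> :: "nat \<Rightarrow> 'a mat" assume \<rho>: "\<forall>x. \<rho> x \<in> carrier (Upm11T n)"
  then have "word_value (semigroup_reduct (Upm11T n)) \<rho> u = word_value (semigroup_reduct (Upm11T n)) \<rho> v"
    using assms holds_in_iff[OF is_semigroup_Upm11T[OF assms(4)] assms(2,3)]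
    by (auto simp: semigroup_reduct_def)
  then show "eval n \<rho> u = eval n \<rho> v"
    using \<rho> assms(2,3) by (simp add: word_value_eval carrier_Upm11T_mat)
qed

lemma finite_carrier_mat: "finite (carrier_mat n m :: 'a::finite mat set)"
proof -
  let ?I = "{..<n} \<times> {..<m}"
  have "finite (?I \<rightarrow>\<^sub>E (UNIV :: 'a set))" by (intro finite_PiE) auto
  moreover have "carrier_mat n m \<subseteq> mat n m ` (?I \<rightarrow>\<^sub>E (UNIV :: 'a set))"
  proof
    fix A :: "'a mat" assume A: "A \<in> carrier_mat n m"
    then have "A = mat n m (restrict (\<lambda>p. A $$ p) ?I)" by (intro eq_matI) auto
    then show "A \<in> mat n m ` (?I \<rightarrow>\<^sub>E UNIV)" by (rule image_eqI[where x = "restrict (\<lambda>p. A $$ p) ?I"]) simp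
  qed
  ultimately show ?thesis by (meson finite_imageI finite_subset)
qed

theorem theorem2p6:
  fixes n :: nat
  assumes "odd CHAR('F::{field,finite})"
    and "n \<ge> 4"
    and "infinite (UNIV :: 'u set)"
  shows "inherently_nfb TYPE('u) (semigroup_reduct (Upm11T n :: 'F mat monoid))"
proof -
  let ?S = "semigroup_reduct (Upm11T n :: 'F mat monoid)"
  have two: "(2 :: 'F) \<noteq> 0"
  proof
    assume "(2 :: 'F) = 0"
    then have "CHAR('F) dvd 2" by (metis of_nat_eq_0_iff_char_dvd of_nat_numeral)
    then have "CHAR('F) \<le> 2" by (rule dvd_imp_le) simp
    then have "CHAR('F) = 1" using assms(1) by presburger
    then show False by simp
  qed
  have semi: "is_semigroup ?S" using assms(2) by (intro is_semigroup_Upm11T) auto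
  have "carrier ?S \<subseteq> carrier_mat n n" by (auto simp: semigroup_reduct_def Upm11T_def)
  then have fin: "finite (carrier ?S)" by (rule finite_subset[OF _ finite_carrier_mat])
  have "is_variety (var_generated ?S :: 'u sgrp set)"
    unfolding is_variety_def var_generated_def
    by (intro exI[of _ "{e \<in> identities. holds_in e ?S}"]) simp
  moreover have "locally_finite (var_generated ?S :: 'u sgrp set)"
    by (rule locally_finite_var_generated[OF semi fin])
  moreover have "\<not> locally_finite V"
    if fb: "finitely_based V" and sub: "var_generated ?S \<subseteq> V" for V :: "'u sgrp set"
  proof -
    obtain \<Sigma> where \<Sigma>: "\<Sigma> \<subseteq> identities" "finite \<Sigma>" "V = models \<Sigma>"
      using fb by (auto simp: finitely_based_def)
    have ne: "u \<noteq> []" "v \<noteq> []" if "(u, v) \<in> identities" for u v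
      using that by (auto simp: identities_def free_sgrp_def)
    \<comment> \<open>The inclusion \<open>sub\<close> speaks only of semigroups over
      \<open>'u\<close>, so it is applied to a copy of the matrix monoid.\<close>
    obtain f :: "'F mat \<Rightarrow> 'u" where f: "inj_on f (carrier ?S)"
      using inj_on_into_infinite[OF countable_finite[OF fin] assms(3)] by blast
    have "copy_sgrp f ?S \<in> var_generated ?S"
      using is_semigroup_copy[OF semi f] holds_in_copy[OF semi f ne]
      by (auto simp: var_generated_def models_def)
    then have "copy_sgrp f ?S \<in> models \<Sigma>" using sub \<Sigma>(3) by blast
    then have hold: "holds_in (u, v) ?S" if "(u, v) \<in> \<Sigma>" for u v
      using that holds_in_copy[OF semi f ne, of u v] \<Sigma>(1) by (auto simp: models_def)
    \<comment> \<open>Symmetric in the two sides, since either of them may be the reducible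
      one.\<close>
    have iso: "w = w'" if "reducible w" "w \<in> {u, v}" "w' \<in> {u, v}" "(u, v) \<in> \<Sigma>" for u v w w'
    proof -
      have "monoid_identity n TYPE('F) u v"
        using \<Sigma>(1) that(4) assms(2) by (intro holds_in_monoid_identity hold ne) auto
      then have "monoid_identity n TYPE('F) w w'"
        using that(2,3) by (auto simp: monoid_identity_def)
      then show ?thesis by (rule reducible_isoterm[OF that(1) _ assms(2) two])
    qed
    \<comment> \<open>The sum bounds the number of variables on each side of each identity. The
      summand 2 is the margin that \<open>encountered_reducible\<close> asks for, and it keeps the
      set of factors infinite even if \<Sigma> is empty.\<close>
    define r where "r = 2 + (\<Sum>(u, v)\<in>\<Sigma>. card (set u) + card (set v))"
    have r: "card (set u) + 2 \<le> r" "card (set v) + 2 \<le> r" if "(u, v) \<in> \<Sigma>" for u v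
      using member_le_sum[OF that, of "\<lambda>(u, v). card (set u) + card (set v)"] \<Sigma>(2)
      by (auto simp: r_def)
    obtain g :: "(nat \<times> nat) list \<Rightarrow> 'u" where "inj g"
      using inj_on_into_infinite[OF countableI_type assms(3)] by blast
    then have g: "inj_on g (carrier (factor_sgrp r))" by (rule inj_on_subset) simp
    have "holds_in e (copy_sgrp g (factor_sgrp r))" if e: "e \<in> \<Sigma>" for e
    proof (cases e)
      case (Pair u v)
      then have uv: "(u, v) \<in> \<Sigma>" "u \<noteq> []" "v \<noteq> []" using e \<Sigma>(1) ne[of u v] by auto
      then have "holds_in (u, v) (factor_sgrp r)"
        using r[OF uv(1)] by (intro factor_sgrp_identity iso[OF _ _ _ uv(1)])
      then show ?thesis
        using holds_in_copy[OF is_semigroup_factor_sgrp g uv(2,3)] Pair by simp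
    qed
    then have "copy_sgrp g (factor_sgrp r) \<in> V"
      using is_semigroup_copy[OF is_semigroup_factor_sgrp g] \<Sigma>(3) by (simp add: models_def)
    moreover have "finitely_generated (copy_sgrp g (factor_sgrp r))"
      by (intro finitely_generated_copy is_semigroup_factor_sgrp g finitely_generated_factor_sgrp)
        (simp add: r_def)
    moreover have "infinite (carrier (copy_sgrp g (factor_sgrp r)))"
      using g infinite_factors[of r] by (simp add: finite_image_iff factor_sgrp_def r_def)
    ultimately show ?thesis unfolding locally_finite_def by blast
  qed
  ultimately show ?thesis
    unfolding inherently_nfb_def inherently_nfb_variety_def by blast
qed

end
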